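(* Let $P$ be a production matrix (finite or infinite). If the vectors $e, Pe, P^2e, P^3e,\ldots$ are linearly dependent (over $\mathbf{R}$), then the induced generating function $f_P(z)$ is rational.
   Context: A production matrix $P$ is a square (finite or infinite, with rows and columns indexed by nonnegative integers) matrix of nonnegative integers, each of whose row sums is a finite positive integer; in particular each row has finitely many nonzero entries, so the products $P^ne$ are well defined. Here $u^\top=(1,0,0,\ldots)$ and $e$ is the column vector with all entries $1$, both of the appropriate size. The sequence induced by $P$ is $a_n=u^\top P^ne$ ($n\geq 0$), and the induced generating function is $f_P(z)=\sum_{n\ge 0}a_nz^n$. Linear dependence of the vectors means that there are $k\ge 0$ and real numbers $\alpha_0,\ldots,\alpha_k$, not all zero, with $\alpha_0e+\alpha_1Pe+\cdots+\alpha_kP^ke=0$. *)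

theory Defs
  imports Complex_Main "HOL-Library.Extended_Nat"
    "HOL-Computational_Algebra.Polynomial_FPS"
begin

text \<open>
  A square matrix of size \<open>N :: enat\<close> is a function \<open>nat \<Rightarrow> nat \<Rightarrow> nat\<close> of which only the entries
  with both indices below \<open>N\<close> matter; \<open>N = \<infinity>\<close> gives the infinite matrices. Column and row
  vectors of size \<open>N\<close> are treated likewise.
\<close>

definition indices :: "enat \<Rightarrow> nat set" where
  "indices N = {i. enat i < N}"

text \<open>
  The product of a row vector and a column vector. The sum runs over the support of the row only,
  so that it is the true value whenever the row has finitely many nonzero entries, also for
  \<open>N = \<infinity>\<close>.
\<close>

definition row_times_col :: "enat \<Rightarrow> (nat \<Rightarrow> nat) \<Rightarrow> (nat \<Rightarrow> nat) \<Rightarrow> nat" where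
  "row_times_col N x y = (\<Sum>j | j \<in> indices N \<and> x j \<noteq> 0. x j * y j)"

definition mat_times_vec :: "enat \<Rightarrow> (nat \<Rightarrow> nat \<Rightarrow> nat) \<Rightarrow> (nat \<Rightarrow> nat) \<Rightarrow> nat \<Rightarrow> nat" where
  "mat_times_vec N A v = (\<lambda>i. row_times_col N (A i) v)"

definition mat_times_mat ::
    "enat \<Rightarrow> (nat \<Rightarrow> nat \<Rightarrow> nat) \<Rightarrow> (nat \<Rightarrow> nat \<Rightarrow> nat) \<Rightarrow> nat \<Rightarrow> nat \<Rightarrow> nat" where
  "mat_times_mat N A B = (\<lambda>i k. row_times_col N (A i) (\<lambda>j. B j k))"

primrec mat_power :: "enat \<Rightarrow> (nat \<Rightarrow> nat \<Rightarrow> nat) \<Rightarrow> nat \<Rightarrow> nat \<Rightarrow> nat \<Rightarrow> nat" where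
  "mat_power N A 0 = (\<lambda>i j. if i = j then 1 else 0)"
| "mat_power N A (Suc n) = mat_times_mat N A (mat_power N A n)"

definition u_vec :: "nat \<Rightarrow> nat" where
  "u_vec i = (if i = 0 then 1 else 0)"

definition e_vec :: "nat \<Rightarrow> nat" where
  "e_vec i = 1"

text \<open>
  A sum of natural numbers is finite iff only finitely many of its terms are nonzero, hence the
  finiteness condition below. The size is nonzero because \<open>u\<close> refers to the index \<open>0\<close>.
\<close>

definition production_matrix :: "enat \<Rightarrow> (nat \<Rightarrow> nat \<Rightarrow> nat) \<Rightarrow> bool" where
  "production_matrix N P \<longleftrightarrow> N > 0 \<and>
     (\<forall>i\<in>indices N. finite {j \<in> indices N. P i j \<noteq> 0} \<and>
        (\<Sum>j | j \<in> indices N \<and> P i j \<noteq> 0. P i j) > 0)"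

definition power_vec :: "enat \<Rightarrow> (nat \<Rightarrow> nat \<Rightarrow> nat) \<Rightarrow> nat \<Rightarrow> nat \<Rightarrow> nat" where
  "power_vec N P n = mat_times_vec N (mat_power N P n) e_vec"

definition induced_seq :: "enat \<Rightarrow> (nat \<Rightarrow> nat \<Rightarrow> nat) \<Rightarrow> nat \<Rightarrow> nat" where
  "induced_seq N P n = row_times_col N u_vec (power_vec N P n)"

definition induced_gf :: "enat \<Rightarrow> (nat \<Rightarrow> nat \<Rightarrow> nat) \<Rightarrow> real fps" where
  "induced_gf N P = Abs_fps (\<lambda>n. real (induced_seq N P n))"

text \<open>
  Dependence of the sequence of vectors as an indexed family: a repetition
  \<open>P\<^sup>m e = P\<^sup>n e\<close> with \<open>m \<noteq> n\<close> counts as a dependence, unlike for \<^const>\<open>dependent\<close>, which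
  would speak about the set of these vectors.
\<close>

definition power_vecs_dependent :: "enat \<Rightarrow> (nat \<Rightarrow> nat \<Rightarrow> nat) \<Rightarrow> bool" where
  "power_vecs_dependent N P \<longleftrightarrow>
     (\<exists>(k :: nat) (\<alpha> :: nat \<Rightarrow> real). (\<exists>j\<le>k. \<alpha> j \<noteq> 0) \<and>
        (\<forall>i\<in>indices N. (\<Sum>j\<le>k. \<alpha> j * real (power_vec N P j i)) = 0))"

text \<open>
  A generating function is a formal power series (it need not converge anywhere in general); the
  nonzero constant coefficient of the denominator makes the quotient one by an invertible series.
\<close>

definition rational_fps :: "real fps \<Rightarrow> bool" where
  "rational_fps F \<longleftrightarrow>
     (\<exists>p q :: real poly. coeff q 0 \<noteq> 0 \<and> F = fps_of_poly p / fps_of_poly q)"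

end

theory Submission
  imports Defs
begin

text \<open>
  A dependence \<open>\<Sum>j\<le>k. \<alpha>\<^sub>j P\<^sup>j e = 0\<close> can be multiplied by \<open>P\<^sup>n\<close> from the left, which gives
  \<open>\<Sum>j\<le>k. \<alpha>\<^sub>j P\<^bsup>n+j\<^esup> e = 0\<close> for every \<open>n\<close> (\<open>dependence_shift\<close>). Read at the index \<open>0\<close>, this is a
  linear recurrence with constant coefficients for the induced sequence, and a sequence that
  satisfies such a recurrence has a rational generating function: the reflected characteristic
  polynomial is a denominator (\<open>rational_fps_if_linear_recurrence\<close>).

  When \<open>P\<close> is infinite, \<open>P\<close> still acts linearly on column vectors because its rows have finite
  support. That \<open>P\<^bsup>n+1\<^esup> e = P (P\<^sup>n e)\<close> (\<open>power_vec_Suc\<close>) is an exchange of two summations, which is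
  legitimate because the rows of \<open>P\<^sup>n\<close> inherit the finite support.
\<close>

section \<open>Powers of a matrix with finitely supported rows\<close>

definition row_support :: "enat \<Rightarrow> (nat \<Rightarrow> nat \<Rightarrow> nat) \<Rightarrow> nat \<Rightarrow> nat set" where
  "row_support N A i = {j \<in> indices N. A i j \<noteq> 0}"

definition finite_rows :: "enat \<Rightarrow> (nat \<Rightarrow> nat \<Rightarrow> nat) \<Rightarrow> bool" where
  "finite_rows N A \<longleftrightarrow> (\<forall>i\<in>indices N. finite (row_support N A i))"

lemma finite_rowsD: "finite_rows N A \<Longrightarrow> i \<in> indices N \<Longrightarrow> finite (row_support N A i)"
  by (simp add: finite_rows_def)

lemma row_support_subset: "row_support N A i \<subseteq> indices N"
  by (auto simp: row_support_def)

lemma row_times_col_row_support: "row_times_col N (A i) y = (\<Sum>j\<in>row_support N A i. A i j * y j)"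
  by (simp add: row_times_col_def row_support_def)

text \<open>
  Rows with different supports can be summed over one common index set, as the exchange of
  summations below requires.
\<close>

lemma row_times_col_superset:
  assumes "finite S" "row_support N A i \<subseteq> S" "S \<subseteq> indices N"
  shows "row_times_col N (A i) y = (\<Sum>j\<in>S. A i j * y j)"
  unfolding row_times_col_row_support
  using assms by (intro sum.mono_neutral_left) (auto simp: row_support_def)

text \<open>
  Row \<open>i\<close> of \<open>A B\<close> is a combination of the rows of \<open>B\<close> that row \<open>i\<close> of \<open>A\<close> selects. This
  keeps the rows of a product finite, and the union serves as the common index set in
  \<open>mat_times_vec_assoc\<close>.
\<close>

lemma row_support_mat_times_mat:
  "row_support N (mat_times_mat N A B) i \<subseteq> (\<Union>j\<in>row_support N A i. row_support N B j)"
proof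
  fix k assume k: "k \<in> row_support N (mat_times_mat N A B) i"
  then have "mat_times_mat N A B i k \<noteq> 0"
    by (simp add: row_support_def)
  then have "(\<Sum>j\<in>row_support N A i. A i j * B j k) \<noteq> 0"
    unfolding mat_times_mat_def row_times_col_row_support .
  then obtain j where "j \<in> row_support N A i" "A i j * B j k \<noteq> 0"
    by (meson sum.neutral)
  with k show "k \<in> (\<Union>j\<in>row_support N A i. row_support N B j)"
    by (auto simp: row_support_def)
qed

lemma finite_UN_row_support:
  assumes "finite_rows N A" "finite_rows N B" "i \<in> indices N"
  shows "finite (\<Union>j\<in>row_support N A i. row_support N B j)"
  using assms row_support_subset[of N A i] by (auto intro!: finite_rowsD)

lemma finite_rows_mat_times_mat:
  assumes "finite_rows N A" "finite_rows N B"
  shows "finite_rows N (mat_times_mat N A B)"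
  unfolding finite_rows_def
  using finite_subset[OF row_support_mat_times_mat finite_UN_row_support[OF assms]] by blast

lemma finite_rows_mat_power:
  assumes "finite_rows N A"
  shows "finite_rows N (mat_power N A n)"
proof (induction n)
  case 0
  have "row_support N (mat_power N A 0) i \<subseteq> {i}" for i
    by (auto simp: row_support_def)
  then show ?case
    unfolding finite_rows_def by (meson finite.emptyI finite.insertI finite_subset)
next
  case (Suc n)
  then show ?case using assms by (simp add: finite_rows_mat_times_mat)
qed

lemma mat_times_vec_assoc:
  assumes A: "finite_rows N A" and B: "finite_rows N B" and i: "i \<in> indices N"
  shows "mat_times_vec N (mat_times_mat N A B) v i = mat_times_vec N A (mat_times_vec N B v) i"
proof -
  define S where "S = (\<Union>j\<in>row_support N A i. row_support N B j)"
  have S: "finite S" "S \<subseteq> indices N"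
    using finite_UN_row_support[OF A B i] row_support_subset by (auto simp: S_def)
  have "mat_times_vec N (mat_times_mat N A B) v i = (\<Sum>k\<in>S. mat_times_mat N A B i k * v k)"
    using S row_support_mat_times_mat[of N A B i]
    by (simp add: mat_times_vec_def row_times_col_superset S_def)
  also have "\<dots> = (\<Sum>k\<in>S. \<Sum>j\<in>row_support N A i. A i j * (B j k * v k))"
    by (simp add: mat_times_mat_def row_times_col_row_support sum_distrib_right mult.assoc)
  also have "\<dots> = (\<Sum>j\<in>row_support N A i. A i j * (\<Sum>k\<in>S. B j k * v k))"
    by (subst sum.swap) (simp add: sum_distrib_left)
  also have "\<dots> = (\<Sum>j\<in>row_support N A i. A i j * mat_times_vec N B v j)"
  proof (rule sum.cong)
    fix j assume "j \<in> row_support N A i"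
    then have "row_support N B j \<subseteq> S" by (auto simp: S_def)
    with S show "A i j * (\<Sum>k\<in>S. B j k * v k) = A i j * mat_times_vec N B v j"
      by (simp add: mat_times_vec_def row_times_col_superset)
  qed simp
  finally show ?thesis
    by (simp add: mat_times_vec_def row_times_col_row_support)
qed

lemma power_vec_Suc:
  assumes "finite_rows N A" "i \<in> indices N"
  shows "power_vec N A (Suc n) i = (\<Sum>j\<in>row_support N A i. A i j * power_vec N A n j)"
  using mat_times_vec_assoc[OF assms(1) finite_rows_mat_power[OF assms(1)] assms(2)]
  by (simp add: power_vec_def mat_times_vec_def row_times_col_row_support)

lemma dependence_shift:
  fixes \<alpha> :: "nat \<Rightarrow> real"
  assumes A: "finite_rows N A"
    and dep: "\<And>i. i \<in> indices N \<Longrightarrow> (\<Sum>j\<le>k. \<alpha> j * real (power_vec N A j i)) = 0"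
    and "i \<in> indices N"
  shows "(\<Sum>j\<le>k. \<alpha> j * real (power_vec N A (n + j) i)) = 0"
  using \<open>i \<in> indices N\<close>
proof (induction n arbitrary: i)
  case 0
  then show ?case using dep by simp
next
  case (Suc n)
  have "(\<Sum>j\<le>k. \<alpha> j * real (power_vec N A (Suc n + j) i)) =
      (\<Sum>j\<le>k. \<Sum>l\<in>row_support N A i. real (A i l) * (\<alpha> j * real (power_vec N A (n + j) l)))"
    using power_vec_Suc[OF A Suc.prems] by (simp add: sum_distrib_left mult_ac)
  also have "\<dots> = (\<Sum>l\<in>row_support N A i.
      real (A i l) * (\<Sum>j\<le>k. \<alpha> j * real (power_vec N A (n + j) l)))"
    by (subst sum.swap) (simp add: sum_distrib_left)
  also have "\<dots> = 0"
    using Suc.IH row_support_subset[of N A i] by (intro sum.neutral) (simp add: subset_iff)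
  finally show ?case .
qed

section \<open>Linear recurrences and rational generating functions\<close>

lemma fps_eq_fps_of_poly_if_eventually_zero:
  fixes F :: "'a :: comm_ring_1 fps"
  assumes "\<And>n. n \<ge> m \<Longrightarrow> fps_nth F n = 0"
  shows "\<exists>p. F = fps_of_poly p"
proof
  show "F = fps_of_poly (Poly (map (fps_nth F) [0..<m]))"
    using assms by (intro fps_ext) (auto simp: nth_default_def)
qed

text \<open>
  Let \<open>m\<close> be the degree of \<open>c\<close>. In the product of the reflected polynomial with the generating
  function, the coefficient of index \<open>n + m\<close> is the left-hand side of the recurrence at \<open>n\<close>, so the
  product is a polynomial. Reflection also turns the leading coefficient of \<open>c\<close> into the constant
  coefficient of the denominator, which makes the denominator invertible.
\<close>

lemma rational_fps_if_linear_recurrence: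
  fixes c :: "real poly" and a :: "nat \<Rightarrow> real"
  assumes "c \<noteq> 0"
    and rec: "\<And>n. (\<Sum>j\<le>degree c. coeff c j * a (n + j)) = 0"
  shows "rational_fps (Abs_fps a)"
proof -
  let ?m = "degree c"
  let ?q = "fps_of_poly (reflect_poly c)"
  have "fps_nth (?q * Abs_fps a) l = 0" if "l \<ge> ?m" for l
  proof -
    from that obtain n where l: "l = n + ?m" by (metis le_Suc_ex add.commute)
    have "fps_nth (?q * Abs_fps a) l = (\<Sum>i=0..l. coeff (reflect_poly c) i * a (l - i))"
      by (simp add: fps_mult_nth)
    also have "\<dots> = (\<Sum>i\<le>?m. coeff (reflect_poly c) i * a (l - i))"
      using that by (intro sum.mono_neutral_right) (auto simp: coeff_reflect_poly)
    also have "\<dots> = (\<Sum>j\<le>?m. coeff c j * a (n + j))"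
      by (rule sum.reindex_bij_witness[of _ "\<lambda>j. ?m - j" "\<lambda>i. ?m - i"])
        (auto simp: coeff_reflect_poly l)
    finally show ?thesis using rec by simp
  qed
  then obtain p where p: "?q * Abs_fps a = fps_of_poly p"
    using fps_eq_fps_of_poly_if_eventually_zero by blast
  have q0: "coeff (reflect_poly c) 0 \<noteq> 0"
    using \<open>c \<noteq> 0\<close> by simp
  then have "?q \<noteq> 0" by (metis coeff_0 fps_of_poly_nth fps_zero_nth)
  then have "Abs_fps a = fps_of_poly p / ?q"
    by (simp flip: p)
  with q0 show ?thesis unfolding rational_fps_def by blast
qed

section \<open>The induced generating function\<close>

lemma induced_seq_eq_power_vec:
  assumes "0 \<in> indices N"
  shows "induced_seq N P n = power_vec N P n 0"
proof -
  have "{j. j \<in> indices N \<and> u_vec j \<noteq> 0} = {0}"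
    using assms by (auto simp: u_vec_def)
  then show ?thesis by (simp add: induced_seq_def row_times_col_def u_vec_def)
qed

theorem proposition5p3:
  fixes N :: enat and P :: "nat \<Rightarrow> nat \<Rightarrow> nat"
  assumes "production_matrix N P"
    and "power_vecs_dependent N P"
  shows "rational_fps (induced_gf N P)"
proof -
  have P: "finite_rows N P" and zero: "0 \<in> indices N"
    using assms(1)
    by (auto simp: production_matrix_def finite_rows_def row_support_def indices_def zero_enat_def)
  obtain k \<alpha> where nz: "\<exists>j\<le>k. \<alpha> j \<noteq> 0"
    and dep: "\<And>i. i \<in> indices N \<Longrightarrow> (\<Sum>j\<le>k. \<alpha> j * real (power_vec N P j i)) = 0"
    using assms(2) unfolding power_vecs_dependent_def by blast
  \<comment> \<open>The coefficient of index \<open>k\<close> may vanish; passing to a polynomial discards such leading zeros.\<close>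
  define c where "c = (\<Sum>j\<le>k. monom (\<alpha> j) j)"
  have coeff_c: "coeff c j = (if j \<le> k then \<alpha> j else 0)" for j
    by (simp add: c_def coeff_sum)
  have "c \<noteq> 0"
    using nz coeff_c by (metis coeff_0)
  have "degree c \<le> k"
    using coeff_c by (intro degree_le) auto
  have "(\<Sum>j\<le>degree c. coeff c j * real (induced_seq N P (n + j))) = 0" for n
  proof -
    have "(\<Sum>j\<le>degree c. coeff c j * real (induced_seq N P (n + j))) =
        (\<Sum>j\<le>k. coeff c j * real (induced_seq N P (n + j)))"
      using \<open>degree c \<le> k\<close> by (intro sum.mono_neutral_left) (auto simp: coeff_eq_0)
    also have "\<dots> = (\<Sum>j\<le>k. \<alpha> j * real (power_vec N P (n + j) 0))"
      by (simp add: coeff_c induced_seq_eq_power_vec[OF zero])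
    finally show ?thesis using dependence_shift[OF P dep zero] by simp
  qed
  with \<open>c \<noteq> 0\<close> show ?thesis
    unfolding induced_gf_def by (rule rational_fps_if_linear_recurrence)
qed

end
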